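(* Let $\mathcal H$ be a complex, infinite-dimensional, separable Hilbert space, let $m\geq2$ be an integer, and let $T$ be a bounded linear operator on $\mathcal H$ which is analytic, norm-increasing and $m$-concave. Let $[\ker T^*]_T$ be the closed $T$-invariant subspace generated by $\ker T^*$. Then either $T$ admits the wandering subspace property or $\mathcal H\ominus[\ker T^*]_T$ is of infinite dimension.
   Context: For a bounded operator $T$ on $\mathcal H$: $T$ is analytic if $\bigcap_{n\geq0}T^n\mathcal H=\{0\}$. $T$ is norm-increasing if $T^*T\geq I$. With $B_m(T)=\sum_{k=0}^m(-1)^k\binom mk T^{*k}T^k$, $T$ is $m$-concave ($m\geq2$) if $(-1)^mB_m(T)\leq0$. $[\ker T^*]_T$ is the closed linear span of $\{T^nh:n\in\mathbb N,\ h\in\ker T^*\}$, where $\mathbb N$ is the set of non-negative integers, and $T$ admits the wandering subspace property if $[\ker T^*]_T=\mathcal H$. $\mathcal H\ominus\mathcal M$ denotes the orthogonal complement of the closed subspace $\mathcal M$ in $\mathcal H$. *)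

theory Defs
  imports "HOL-Analysis.Analysis"
begin

section \<open>Complex Hilbert spaces\<close>

text \<open>
  The inner product is linear in the first argument. The class extends \<^class>\<open>real_inner\<close>, the
  real structure being the underlying one: the norm and topology are thus those induced by the
  complex inner product, and positive definiteness is inherited.
\<close>

class complex_inner = real_inner +
  fixes scaleC :: "complex \<Rightarrow> 'a \<Rightarrow> 'a" (infixr \<open>*\<^sub>C\<close> 75)
    and cinner :: "'a \<Rightarrow> 'a \<Rightarrow> complex"
  assumes scaleC_add_right: "a *\<^sub>C (x + y) = a *\<^sub>C x + a *\<^sub>C y"
    and scaleC_add_left: "(a + b) *\<^sub>C x = a *\<^sub>C x + b *\<^sub>C x"
    and scaleC_scaleC: "a *\<^sub>C (b *\<^sub>C x) = (a * b) *\<^sub>C x"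
    and scaleC_of_real: "complex_of_real r *\<^sub>C x = r *\<^sub>R x"
    and cinner_commute: "cinner x y = cnj (cinner y x)"
    and cinner_add_left: "cinner (x + y) z = cinner x z + cinner y z"
    and cinner_scaleC_left: "cinner (a *\<^sub>C x) y = a * cinner x y"
    and Re_cinner: "Re (cinner x y) = inner x y"

class chilbert_space = complex_inner + complete_space

global_interpretation complex_vector: vector_space "scaleC :: complex \<Rightarrow> 'a \<Rightarrow> 'a::complex_inner"
proof unfold_locales
  show "1 *\<^sub>C x = x" for x :: 'a
    using scaleC_of_real[of 1 x] by simp
qed (simp_all add: scaleC_add_right scaleC_add_left scaleC_scaleC)

text \<open>Meant for complex linear subspaces \<^term>\<open>M\<close>.\<close>

definition cfinite_dim :: "'a::complex_inner set \<Rightarrow> bool" where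
  "cfinite_dim M \<longleftrightarrow> (\<exists>B. finite B \<and> complex_vector.span B = M)"

definition orth_compl :: "'a::complex_inner set \<Rightarrow> 'a set" where
  "orth_compl M = {x. \<forall>y\<in>M. cinner x y = 0}"


section \<open>Bounded operators\<close>

definition bounded_clinear :: "('a::complex_inner \<Rightarrow> 'a) \<Rightarrow> bool" where
  "bounded_clinear T \<longleftrightarrow>
     Vector_Spaces.linear scaleC scaleC T \<and> (\<exists>K. \<forall>x. norm (T x) \<le> K * norm x)"

definition cadjoint :: "('a::complex_inner \<Rightarrow> 'a) \<Rightarrow> 'a \<Rightarrow> 'a" where
  "cadjoint T = (THE S. \<forall>x y. cinner (T x) y = cinner x (S y))"

definition positive_op :: "('a::complex_inner \<Rightarrow> 'a) \<Rightarrow> bool" where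
  "positive_op A \<longleftrightarrow> (\<forall>x. cinner (A x) x \<in> \<real>\<^sub>\<ge>\<^sub>0)"

definition op_le :: "('a::complex_inner \<Rightarrow> 'a) \<Rightarrow> ('a \<Rightarrow> 'a) \<Rightarrow> bool" where
  "op_le A B \<longleftrightarrow> positive_op (\<lambda>x. B x - A x)"

definition analytic_op :: "('a::complex_inner \<Rightarrow> 'a) \<Rightarrow> bool" where
  "analytic_op T \<longleftrightarrow> (\<Inter>n. range (T ^^ n)) = {0}"

definition norm_increasing :: "('a::complex_inner \<Rightarrow> 'a) \<Rightarrow> bool" where
  "norm_increasing T \<longleftrightarrow> op_le (\<lambda>x. x) (cadjoint T \<circ> T)"

definition B_op :: "nat \<Rightarrow> ('a::complex_inner \<Rightarrow> 'a) \<Rightarrow> 'a \<Rightarrow> 'a" where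
  "B_op m T x =
     (\<Sum>k=0..m. ((-1) ^ k * of_nat (m choose k)) *\<^sub>C (cadjoint T ^^ k) ((T ^^ k) x))"

definition m_concave :: "nat \<Rightarrow> ('a::complex_inner \<Rightarrow> 'a) \<Rightarrow> bool" where
  "m_concave m T \<longleftrightarrow> op_le (\<lambda>x. (-1) ^ m *\<^sub>C B_op m T x) (\<lambda>x. 0)"

definition ker_adj :: "('a::complex_inner \<Rightarrow> 'a) \<Rightarrow> 'a set" where
  "ker_adj T = {h. cadjoint T h = 0}"

definition invariant_hull :: "('a::complex_inner \<Rightarrow> 'a) \<Rightarrow> 'a set \<Rightarrow> 'a set" where
  "invariant_hull T E = closure (complex_vector.span {(T ^^ n) h | n h. h \<in> E})"

definition wandering_subspace_property :: "('a::complex_inner \<Rightarrow> 'a) \<Rightarrow> bool" where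
  "wandering_subspace_property T \<longleftrightarrow> invariant_hull T (ker_adj T) = UNIV"


section \<open>Existence of the adjoint\<close>

lemma riesz_real:
  fixes f :: "'a::{real_inner,complete_space} \<Rightarrow> real"
  assumes "bounded_linear f"
  obtains z where "\<And>x. f x = inner x z"
proof -
  interpret f: bounded_linear f by fact
  obtain K where K: "\<And>x. norm (f x) \<le> norm x * K" using f.bounded by blast
  define \<phi> where "\<phi> x = inner x x / 2 - f x" for x
  have bd: "\<phi> x \<ge> - K\<^sup>2 / 2" for x
  proof -
    have "0 \<le> (norm x - K)\<^sup>2" by simp
    moreover have "f x \<le> norm x * K" using K[of x] by simp
    ultimately show ?thesis
      by (simp add: \<phi>_def power2_norm_eq_inner[symmetric] power2_diff)
  qed
  define m where "m = (INF x. \<phi> x)"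
  have bdd: "bdd_below (range \<phi>)" using bd by (intro bdd_belowI) auto
  have m: "m \<le> \<phi> x" for x unfolding m_def using bdd by (simp add: cINF_lower)
  have "\<exists>x. \<phi> x < m + 1 / Suc n" for n
    using cINF_less_iff[OF _ bdd, of "m + 1 / Suc n"] by (simp add: m_def)
  then obtain X where X: "\<And>n. \<phi> (X n) < m + 1 / Suc n" by metis
  have par: "(dist x y)\<^sup>2 \<le> 4 * (\<phi> x - m) + 4 * (\<phi> y - m)" for x y
  proof -
    have "(dist x y)\<^sup>2 = 4 * (\<phi> x + \<phi> y - 2 * \<phi> ((1/2) *\<^sub>R (x + y)))"
      by (simp add: \<phi>_def dist_norm power2_norm_eq_inner f.scaleR f.add inner_diff inner_add
          inner_commute algebra_simps)
    then show ?thesis using m[of "(1/2) *\<^sub>R (x + y)"] by simp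
  qed
  have "Cauchy X"
  proof (rule metric_CauchyI)
    fix e :: real assume "e > 0"
    then obtain N where N: "1 / real (Suc N) < e\<^sup>2 / 8"
      by (metis nat_approx_posE zero_less_divide_iff zero_less_numeral zero_less_power)
    have small: "\<phi> (X n) - m < e\<^sup>2 / 8" if "n \<ge> N" for n
    proof -
      have "1 / real (Suc n) \<le> 1 / real (Suc N)" using that by (simp add: frac_le)
      then show ?thesis using X[of n] N by linarith
    qed
    have "dist (X i) (X j) < e" if "i \<ge> N" "j \<ge> N" for i j
    proof -
      have "4 * (\<phi> (X i) - m) + 4 * (\<phi> (X j) - m) < 4 * (e\<^sup>2 / 8) + 4 * (e\<^sup>2 / 8)"
        using small[OF that(1)] small[OF that(2)] by (intro add_strict_mono) auto
      with par[of "X i" "X j"] have "(dist (X i) (X j))\<^sup>2 < e\<^sup>2" by simp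
      then show ?thesis using \<open>e > 0\<close> by (simp add: power_less_imp_less_base)
    qed
    then show "\<exists>N. \<forall>i\<ge>N. \<forall>j\<ge>N. dist (X i) (X j) < e" by blast
  qed
  then obtain z where z: "X \<longlonglongrightarrow> z" using Cauchy_convergent_iff convergent_def by blast
  have "(\<lambda>n. \<phi> (X n)) \<longlonglongrightarrow> \<phi> z"
    unfolding \<phi>_def by (intro tendsto_intros z f.tendsto) simp
  moreover have "(\<lambda>n. \<phi> (X n)) \<longlonglongrightarrow> m"
  proof (rule tendsto_sandwich[of "\<lambda>_. m" _ _ "\<lambda>n. m + 1 / Suc n"])
    show "(\<lambda>n. m + 1 / real (Suc n)) \<longlonglongrightarrow> m"
      using tendsto_add[OF tendsto_const[of m] LIMSEQ_inverse_real_of_nat]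
      by (simp add: inverse_eq_divide)
  qed (use m X in \<open>auto intro!: always_eventually less_imp_le\<close>)
  ultimately have \<phi>z: "\<phi> z = m" using LIMSEQ_unique by blast
  have "f h = inner h z" for h
  proof (rule ccontr)
    assume ne: "f h \<noteq> inner h z"
    define c where "c = inner h z - f h"
    define q where "q = inner h h"
    have ineq: "0 \<le> t * c + t\<^sup>2 * q / 2" for t
    proof -
      have "\<phi> (z + t *\<^sub>R h) = \<phi> z + t * c + t\<^sup>2 * q / 2"
        by (simp add: \<phi>_def c_def q_def f.add f.scaleR inner_add inner_commute
            algebra_simps power2_eq_square add_divide_distrib)
      then show ?thesis using m[of "z + t *\<^sub>R h"] \<phi>z by simp
    qed
    have q: "q \<ge> 0" by (simp add: q_def)
    have "0 \<le> - (c\<^sup>2 / (q + 1)) + (c\<^sup>2 / (q + 1)) * (q / (q + 1)) / 2"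
      using ineq[of "- c / (q + 1)"] by (simp add: power2_eq_square)
    also have "\<dots> = (c\<^sup>2 / (q + 1)) * (q / (q + 1) / 2 - 1)" by (simp add: algebra_simps)
    also have "\<dots> < 0"
    proof (rule mult_pos_neg)
      show "c\<^sup>2 / (q + 1) > 0" using ne q by (simp add: c_def)
      show "q / (q + 1) / 2 - 1 < 0" using q by (simp add: field_simps)
    qed
    finally show False by simp
  qed
  then show thesis using that by blast
qed

lemma cinner_eqI:
  fixes x y :: "'a::complex_inner"
  assumes "\<And>z. cinner z x = cinner z y"
  shows "x = y"
proof -
  have "inner (x - y) x = inner (x - y) y"
    using assms by (metis Re_cinner)
  then have "inner (x - y) (x - y) = 0" by (simp add: inner_diff_right)
  then show ?thesis by simp
qed

lemma cinner_cadjoint: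
  fixes T :: "'a::chilbert_space \<Rightarrow> 'a"
  assumes "bounded_clinear T"
  shows "cinner (T x) y = cinner x (cadjoint T y)"
proof -
  interpret T: Vector_Spaces.linear scaleC scaleC T
    using assms by (simp add: bounded_clinear_def)
  obtain K where K: "\<And>x. norm (T x) \<le> K * norm x"
    using assms by (auto simp: bounded_clinear_def)
  have "bounded_linear T"
  proof
    show "T (r *\<^sub>R x) = r *\<^sub>R T x" for r x
      by (metis T.scale scaleC_of_real)
    show "\<exists>K. \<forall>x. norm (T x) \<le> norm x * K" using K by (metis mult.commute)
  qed (rule T.add)
  then have "bounded_linear (\<lambda>x. inner (T x) y)" for y
    by (rule bounded_linear_inner_left_comp)
  then have "\<exists>z. \<forall>x. inner (T x) y = inner x z" for y
    by (metis riesz_real)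
  then obtain S where S: "\<And>x y. inner (T x) y = inner x (S y)" by metis
  have Im: "Im (cinner u v) = inner ((- \<i>) *\<^sub>C u) v" for u v :: 'a
    unfolding Re_cinner[symmetric] cinner_scaleC_left by simp
  have S': "cinner (T x) y = cinner x (S y)" for x y
  proof (rule complex_eqI)
    show "Re (cinner (T x) y) = Re (cinner x (S y))" by (simp only: Re_cinner S)
    have "Im (cinner (T x) y) = inner (T ((- \<i>) *\<^sub>C x)) y" by (simp only: Im T.scale)
    also have "\<dots> = Im (cinner x (S y))" by (simp only: S Im)
    finally show "Im (cinner (T x) y) = Im (cinner x (S y))" .
  qed
  have "cadjoint T = S"
    unfolding cadjoint_def
  proof (rule the_equality)
    show "R = S" if R: "\<forall>x y. cinner (T x) y = cinner x (R y)" for R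
    proof
      fix y show "R y = S y"
        by (rule cinner_eqI) (use R S' in simp)
    qed
  qed (use S' in blast)
  then show ?thesis using S' by simp
qed

end

theory Submission
  imports Defs "HOL-Computational_Algebra.Fundamental_Theorem_Algebra" "HOL-Real_Asymp.Real_Asymp"
begin

text \<open>
  A vector is orthogonal to \<open>[ker T\<^sup>*]\<^sub>T\<close> iff its whole orbit under \<open>T\<^sup>*\<close> is orthogonal to
  \<open>ker T\<^sup>*\<close>. This orthogonal complement is therefore invariant under \<open>T\<^sup>*\<close>, and it is contained in
  the range of \<open>T\<close>, which is closed because \<open>T\<close> is norm-increasing. If it is nonzero and of finite
  dimension, then it contains an eigenvector \<open>v = T u\<close> of \<open>T\<^sup>*\<close>, with eigenvalue \<open>\<lambda>\<close> say. By
  \<open>m\<close>-concavity the orbits of \<open>T\<close> grow at most polynomially, so \<open>\<bar>\<lambda>\<bar> \<le> 1\<close>. Comparing with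
  \<open>\<parallel>T u\<parallel> \<ge> \<parallel>u\<parallel>\<close> gives equality in the Cauchy--Schwarz inequality for \<open>\<lambda> T u\<close> and \<open>u\<close>, hence
  \<open>u = \<lambda> v\<close> and \<open>v = \<lambda> T v\<close>. So \<open>v\<close> lies in the range of every power of \<open>T\<close>, contradicting
  analyticity.
\<close>

section \<open>Complex inner products and orthogonal complements\<close>

lemma cinner_scaleC_right: "cinner x (a *\<^sub>C y) = cnj a * cinner x (y :: 'a::complex_inner)"
  by (metis cinner_commute cinner_scaleC_left complex_cnj_mult)

lemma cinner_add_right: "cinner x (y + z) = cinner x y + cinner x (z :: 'a::complex_inner)"
  by (metis cinner_commute cinner_add_left complex_cnj_add)

lemma cinner_zero_left [simp]: "cinner 0 (x :: 'a::complex_inner) = 0"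
  using cinner_add_left[of 0 0 x] by simp

lemma cinner_zero_right [simp]: "cinner (x :: 'a::complex_inner) 0 = 0"
  using cinner_add_right[of x 0 0] by simp

lemma cinner_diff_left: "cinner (x - y) z = cinner x z - cinner y (z :: 'a::complex_inner)"
  using cinner_add_left[of "x - y" y z] by simp

text \<open>Turns imaginary parts into real inner products, so that facts about the underlying real
  space settle both components of \<open>cinner\<close>.\<close>

lemma Im_cinner: "Im (cinner x y) = inner (x :: 'a::complex_inner) (\<i> *\<^sub>C y)"
  by (simp add: Re_cinner[symmetric] cinner_scaleC_right)

lemma Im_cinner_left: "Im (cinner x y) = inner ((- \<i>) *\<^sub>C x) (y :: 'a::complex_inner)"
  unfolding Re_cinner[symmetric] cinner_scaleC_left by simp

lemma cinner_self: "cinner x x = complex_of_real ((norm (x :: 'a::complex_inner))\<^sup>2)"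
proof (rule complex_eqI)
  show "Re (cinner x x) = Re (complex_of_real ((norm x)\<^sup>2))"
    by (simp add: Re_cinner power2_norm_eq_inner)
  have "Im (cinner x x) = - Im (cinner x x)"
    by (metis cinner_commute cnj.simps(2))
  then show "Im (cinner x x) = Im (complex_of_real ((norm x)\<^sup>2))" by simp
qed

lemma norm_scaleC: "norm (a *\<^sub>C x) = cmod a * norm (x :: 'a::complex_inner)"
proof (rule power2_eq_imp_eq)
  have "complex_of_real ((norm (a *\<^sub>C x))\<^sup>2) = a * cnj a * complex_of_real ((norm x)\<^sup>2)"
    unfolding cinner_self[symmetric] by (simp add: cinner_scaleC_left cinner_scaleC_right)
  also have "\<dots> = complex_of_real ((cmod a * norm x)\<^sup>2)"
    by (simp add: complex_norm_square[symmetric] power_mult_distrib)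
  finally show "(norm (a *\<^sub>C x))\<^sup>2 = (cmod a * norm x)\<^sup>2" using of_real_eq_iff by blast
qed simp_all

lemma subspace_complex_subspace:
  assumes "complex_vector.subspace S"
  shows "subspace S"
proof (rule subspaceI)
  show "c *\<^sub>R x \<in> S" if "x \<in> S" for c x
    using complex_vector.subspace_scale[OF assms that, of "complex_of_real c"]
    by (simp add: scaleC_of_real)
qed (use assms in \<open>auto simp: complex_vector.subspace_0 complex_vector.subspace_add\<close>)

lemma closed_cinner_zero: "closed {y. cinner (x :: 'a::complex_inner) y = 0}"
proof -
  \<comment> \<open>Real and imaginary parts are separated because continuity is at hand for the
    real \<open>inner\<close>.\<close>
  have "{y. cinner x y = 0} = {y. inner x y = 0} \<inter> {y. inner ((- \<i>) *\<^sub>C x) y = 0}"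
    by (auto simp: complex_eq_iff Re_cinner Im_cinner_left simp del: complex_vector.scale_minus_left)
  also have "closed \<dots>"
    by (intro closed_Int closed_Collect_eq continuous_intros)
  finally show ?thesis .
qed

text \<open>For fixed \<open>x\<close>, the vectors \<open>y\<close> with
  \<open>cinner x y = 0\<close> form a closed complex subspace, so this set contains the closed span
  of \<open>G\<close> as soon as it contains \<open>G\<close>.\<close>

lemma orth_compl_closure_span:
  "orth_compl (closure (complex_vector.span G)) = orth_compl (G :: 'a::complex_inner set)"
proof (intro equalityI subsetI)
  fix x assume "x \<in> orth_compl (closure (complex_vector.span G))"
  then show "x \<in> orth_compl G"
    using complex_vector.span_superset[of G] closure_subset[of "complex_vector.span G"]
    by (auto simp: orth_compl_def)
next
  fix x assume x: "x \<in> orth_compl G"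
  have "complex_vector.span G \<subseteq> {y. cinner x y = 0}"
    by (rule complex_vector.span_minimal)
      (use x in \<open>auto simp: orth_compl_def cinner_add_right cinner_scaleC_right
        intro!: complex_vector.subspaceI\<close>)
  then have "closure (complex_vector.span G) \<subseteq> {y. cinner x y = 0}"
    by (rule closure_minimal) (rule closed_cinner_zero)
  then show "x \<in> orth_compl (closure (complex_vector.span G))"
    by (auto simp: orth_compl_def)
qed

section \<open>Orthogonal projection onto closed subspaces\<close>

text \<open>The point \<open>p\<close> is the point of \<open>S\<close> nearest to \<open>x\<close>:
  a minimizing sequence is Cauchy by the parallelogram law, and minimality along each line through
  \<open>p\<close> in \<open>S\<close> forces orthogonality.\<close>

lemma closed_subspace_projection:
  fixes S :: "'a::{real_inner,complete_space} set"
  assumes "subspace S" "closed S"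
  obtains p where "p \<in> S" "\<And>y. y \<in> S \<Longrightarrow> inner (x - p) y = 0"
proof -
  have ne: "S \<noteq> {}" using assms(1) subspace_0 by blast
  define d where "d = infdist x S"
  have d: "d \<le> dist x y" if "y \<in> S" for y using that by (simp add: d_def infdist_le)
  have d0: "d \<ge> 0" by (simp add: d_def infdist_nonneg)
  have "\<exists>y\<in>S. (dist x y)\<^sup>2 < d\<^sup>2 + 1 / Suc n" for n
  proof (rule ccontr)
    assume "\<not> ?thesis"
    \<comment> \<open>Otherwise this square root, which exceeds \<open>d\<close>, would be a lower
      bound for all distances from \<open>x\<close> to \<open>S\<close>.\<close>
    then have "sqrt (d\<^sup>2 + 1 / Suc n) \<le> dist x y" if "y \<in> S" for y
      using that real_le_lsqrt[of "dist x y"] by (force simp: not_less)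
    then have "sqrt (d\<^sup>2 + 1 / Suc n) \<le> d"
      unfolding d_def infdist_notempty[OF ne] by (intro cINF_greatest ne)
    then have "sqrt (d\<^sup>2 + 1 / Suc n) \<le> sqrt (d\<^sup>2)" using d0 by simp
    then show False unfolding real_sqrt_le_iff by simp
  qed
  then obtain X where XS: "\<And>n. X n \<in> S" and X: "\<And>n. (dist x (X n))\<^sup>2 < d\<^sup>2 + 1 / Suc n"
    by metis
  \<comment> \<open>Parallelogram law; the midpoint of \<open>y\<close> and \<open>z\<close> lies in
    \<open>S\<close>, hence at distance at least \<open>d\<close> from \<open>x\<close>.\<close>
  have par: "(dist y z)\<^sup>2 \<le> 2 * ((dist x y)\<^sup>2 - d\<^sup>2) + 2 * ((dist x z)\<^sup>2 - d\<^sup>2)"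
    if "y \<in> S" "z \<in> S" for y z
  proof -
    have "(1/2) *\<^sub>R (y + z) \<in> S" using that assms(1) by (simp add: subspace_add subspace_scale)
    then have "d\<^sup>2 \<le> (dist x ((1/2) *\<^sub>R (y + z)))\<^sup>2" using d d0 by (intro power_mono) auto
    moreover have "(dist y z)\<^sup>2 =
        2 * (dist x y)\<^sup>2 + 2 * (dist x z)\<^sup>2 - 4 * (dist x ((1/2) *\<^sub>R (y + z)))\<^sup>2"
      by (simp add: dist_norm power2_norm_eq_inner inner_diff inner_add inner_commute algebra_simps)
    ultimately show ?thesis by simp
  qed
  have "Cauchy X"
  proof (rule metric_CauchyI)
    fix e :: real assume "e > 0"
    then obtain N where N: "1 / real (Suc N) < e\<^sup>2 / 4"
      by (metis nat_approx_posE zero_less_divide_iff zero_less_numeral zero_less_power)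
    have small: "(dist x (X n))\<^sup>2 - d\<^sup>2 < e\<^sup>2 / 4" if "n \<ge> N" for n
    proof -
      have "1 / real (Suc n) \<le> 1 / real (Suc N)" using that by (simp add: frac_le)
      then show ?thesis using X[of n] N by linarith
    qed
    have "dist (X i) (X j) < e" if "i \<ge> N" "j \<ge> N" for i j
    proof -
      have "(dist (X i) (X j))\<^sup>2
          \<le> 2 * ((dist x (X i))\<^sup>2 - d\<^sup>2) + 2 * ((dist x (X j))\<^sup>2 - d\<^sup>2)"
        by (rule par) (rule XS)+
      also have "\<dots> < 2 * (e\<^sup>2 / 4) + 2 * (e\<^sup>2 / 4)"
        using small[OF that(1)] small[OF that(2)] by (intro add_strict_mono) auto
      also have "\<dots> = e\<^sup>2" by simp
      finally have "(dist (X i) (X j))\<^sup>2 < e\<^sup>2" .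
      then show ?thesis using \<open>e > 0\<close> by (simp add: power_less_imp_less_base)
    qed
    then show "\<exists>N. \<forall>i\<ge>N. \<forall>j\<ge>N. dist (X i) (X j) < e" by blast
  qed
  then obtain p where p: "X \<longlonglongrightarrow> p" using Cauchy_convergent_iff convergent_def by blast
  have pS: "p \<in> S" using closed_sequentially[OF assms(2) _ p] XS by blast
  have "(\<lambda>n. (dist x (X n))\<^sup>2) \<longlonglongrightarrow> (dist x p)\<^sup>2" by (intro tendsto_intros p)
  moreover have "(\<lambda>n. d\<^sup>2 + 1 / Suc n) \<longlonglongrightarrow> d\<^sup>2 + 0"
    by (intro tendsto_intros LIMSEQ_inverse_real_of_nat[unfolded inverse_eq_divide])
  ultimately have "(dist x p)\<^sup>2 \<le> d\<^sup>2 + 0"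
    using X by (blast intro: LIMSEQ_le less_imp_le)
  then have pd: "(dist x p)\<^sup>2 \<le> d\<^sup>2" by simp
  have "inner (x - p) y = 0" if y: "y \<in> S" for y
  proof -
    define c where "c = inner (x - p) y"
    \<comment> \<open>The minimizer over \<open>t\<close> of the squared distance to
      \<open>p + t y\<close> would be \<open>c / inner y y\<close>; the added 1 keeps the
      denominator positive when \<open>y = 0\<close> and still forces \<open>t = 0\<close>
      below.\<close>
    define t where "t = c / (inner y y + 1)"
    have q: "inner y y \<ge> 0" by simp
    have "p + t *\<^sub>R y \<in> S" using assms(1) y pS by (simp add: subspace_add subspace_scale)
    then have "(dist x p)\<^sup>2 \<le> (dist x (p + t *\<^sub>R y))\<^sup>2"
      using d d0 pd by (meson order_trans power_mono)
    also have "\<dots> = (dist x p)\<^sup>2 - 2 * t * c + t\<^sup>2 * inner y y"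
      unfolding dist_norm power2_norm_eq_inner
      by (simp add: c_def inner_diff inner_add inner_commute algebra_simps power2_eq_square)
    finally have "2 * t * c \<le> t\<^sup>2 * inner y y" by simp
    moreover have "c = t * (inner y y + 1)" using q by (simp add: t_def add_nonneg_eq_0_iff)
    ultimately have "t\<^sup>2 * (inner y y + 2) \<le> 0" by (simp add: power2_eq_square algebra_simps)
    then have "t = 0" using q by (simp add: mult_le_0_iff)
    then show ?thesis using \<open>c = t * _\<close> by (simp add: c_def)
  qed
  with pS show thesis using that by blast
qed

text \<open>The real projection suffices: \<open>S\<close> is stable under multiplication by
  \<open>\<i>\<close>, so real orthogonality to \<open>S\<close> also kills the imaginary part of
  \<open>cinner\<close>.\<close>

lemma closed_complex_subspace_projection:
  fixes S :: "'a::chilbert_space set"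
  assumes "complex_vector.subspace S" "closed S"
  obtains p where "p \<in> S" "x - p \<in> orth_compl S"
proof -
  obtain p where p: "p \<in> S" "\<And>y. y \<in> S \<Longrightarrow> inner (x - p) y = 0"
    using closed_subspace_projection[OF subspace_complex_subspace assms(2)] assms(1) by blast
  have "cinner (x - p) y = 0" if "y \<in> S" for y
    using p(2)[OF that] p(2)[of "\<i> *\<^sub>C y"] complex_vector.subspace_scale[OF assms(1) that]
    by (simp add: complex_eq_iff Re_cinner Im_cinner)
  then show thesis using that p(1) by (simp add: orth_compl_def)
qed

text \<open>Each \<open>x\<close> differs from its projection onto the closure by a vector of the
  orthogonal complement, that is, by 0. This turns a trivial complement into the wandering subspace
  property.\<close>

lemma orth_compl_closure_eq_zero:
  fixes S :: "'a::chilbert_space set"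
  assumes "complex_vector.subspace S" "orth_compl (closure S) = {0}"
  shows "closure S = UNIV"
proof -
  have cS: "complex_vector.subspace (closure S)"
  proof (rule complex_vector.subspaceI)
    show "0 \<in> closure S"
      using closure_subset complex_vector.subspace_0[OF assms(1)] by blast
    show "x + y \<in> closure S" if xy: "x \<in> closure S" "y \<in> closure S" for x y
    proof -
      obtain X Y where "\<And>n. X n \<in> S" "X \<longlonglongrightarrow> x" "\<And>n. Y n \<in> S" "Y \<longlonglongrightarrow> y"
        using xy closure_sequential by metis
      then have "(\<lambda>n. X n + Y n) \<longlonglongrightarrow> x + y" "\<And>n. X n + Y n \<in> S"
        using complex_vector.subspace_add[OF assms(1)] by (auto intro: tendsto_add)
      then show ?thesis
        unfolding closure_sequential by (intro exI[of _ "\<lambda>n. X n + Y n"]) simp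
    qed
    show "c *\<^sub>C x \<in> closure S" if x: "x \<in> closure S" for c x
    proof -
      obtain X where X: "\<And>n. X n \<in> S" "X \<longlonglongrightarrow> x" using x closure_sequential by blast
      \<comment> \<open>Supplies the continuity of scalar multiplication, with bound
        \<open>cmod c\<close>.\<close>
      have "bounded_linear (\<lambda>x. c *\<^sub>C (x :: 'a))"
        by (rule bounded_linear_intro[of _ "cmod c"])
          (simp_all add: scaleC_add_right norm_scaleC scaleC_of_real[symmetric] scaleC_scaleC
            mult.commute)
      then have "(\<lambda>n. c *\<^sub>C X n) \<longlonglongrightarrow> c *\<^sub>C x" using X(2) by (rule bounded_linear.tendsto)
      then show ?thesis
        using X(1) complex_vector.subspace_scale[OF assms(1)]
        unfolding closure_sequential by (intro exI[of _ "\<lambda>n. c *\<^sub>C X n"]) simp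
    qed
  qed
  have "x \<in> closure S" for x
  proof -
    obtain p where "p \<in> closure S" "x - p \<in> orth_compl (closure S)"
      using closed_complex_subspace_projection[OF cS closed_closure] by blast
    then show ?thesis using assms(2) by simp
  qed
  then show ?thesis by blast
qed


section \<open>Eigenvectors in finite-dimensional invariant subspaces\<close>

text \<open>The vector \<open>p(A) v\<close> of the polynomial calculus of \<open>A\<close>.\<close>

definition op_poly :: "('a::complex_inner \<Rightarrow> 'a) \<Rightarrow> complex poly \<Rightarrow> 'a \<Rightarrow> 'a" where
  "op_poly A p v = (\<Sum>i\<le>degree p. coeff p i *\<^sub>C (A ^^ i) v)"

lemma op_poly_altdef:
  assumes "degree p \<le> n"
  shows "op_poly A p v = (\<Sum>i\<le>n. coeff p i *\<^sub>C (A ^^ i) v)"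
  unfolding op_poly_def
  by (rule sum.mono_neutral_left) (use assms in \<open>auto simp: coeff_eq_0\<close>)

text \<open>Multiplying \<open>q\<close> by the indeterminate shifts its coefficients by one place,
  which amounts to one more application of \<open>A\<close>. A root \<open>c\<close> of a polynomial
  thus splits off the operator \<open>A - c\<close>.\<close>

lemma op_poly_linear_factor:
  assumes A: "Vector_Spaces.linear scaleC scaleC A"
  shows "op_poly A ([:-c, 1:] * q) v = A (op_poly A q v) - c *\<^sub>C op_poly A q v"
proof -
  interpret A: Vector_Spaces.linear scaleC scaleC A by fact
  have eq: "[:-c, 1:] * q = pCons 0 q - smult c q" by simp
  have "degree ([:-c, 1:] * q) \<le> Suc (degree q)"
    by (rule order_trans[OF degree_mult_le]) simp
  then have "op_poly A ([:-c, 1:] * q) v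
      = (\<Sum>i\<le>Suc (degree q). coeff ([:-c, 1:] * q) i *\<^sub>C (A ^^ i) v)"
    by (rule op_poly_altdef)
  also have "\<dots> = (\<Sum>i\<le>Suc (degree q). coeff (pCons 0 q) i *\<^sub>C (A ^^ i) v)
      - (\<Sum>i\<le>Suc (degree q). (c * coeff q i) *\<^sub>C (A ^^ i) v)"
    unfolding eq by (simp only: coeff_diff coeff_smult complex_vector.scale_left_diff_distrib
        sum_subtractf)
  also have "(\<Sum>i\<le>Suc (degree q). coeff (pCons 0 q) i *\<^sub>C (A ^^ i) v) = A (op_poly A q v)"
    unfolding sum.atMost_Suc_shift by (simp add: op_poly_def A.sum A.scale)
  also have "(\<Sum>i\<le>Suc (degree q). (c * coeff q i) *\<^sub>C (A ^^ i) v) = c *\<^sub>C op_poly A q v"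
    unfolding op_poly_altdef[OF le_SucI[OF order_refl]] complex_vector.scale_sum_right
    by (simp only: scaleC_scaleC)
  finally show ?thesis .
qed

lemma funpow_in_invariant:
  assumes "\<And>x. x \<in> M \<Longrightarrow> A x \<in> M" "v \<in> M"
  shows "(A ^^ n) v \<in> M"
  using assms by (induction n) auto

text \<open>The \<open>card B + 1\<close> iterates of \<open>v\<close> with exponents up to
  \<open>card B\<close> lie in the span of \<open>card B\<close> vectors; the coefficients of a
  linear relation among them are those of \<open>p\<close>.\<close>

lemma cfinite_dim_annihilating_poly:
  assumes fin: "cfinite_dim M" and inv: "\<And>x. x \<in> M \<Longrightarrow> A x \<in> M" and v: "v \<in> M"
  obtains p where "p \<noteq> 0" "op_poly A p v = 0"
proof -
  obtain B where B: "finite B" "complex_vector.span B = M" using fin by (auto simp: cfinite_dim_def)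
  let ?f = "\<lambda>i. (A ^^ i) v"
  let ?I = "{..card B}"
  have "\<exists>c. (\<exists>i\<in>?I. c i \<noteq> 0) \<and> (\<Sum>i\<in>?I. c i *\<^sub>C ?f i) = 0"
  \<comment> \<open>Dependence is a property of the set of iterates, so coinciding iterates are
    treated apart: there the relation is the difference of two equal ones.\<close>
  proof (cases "inj_on ?f ?I")
    case True
    have "card (?f ` ?I) = Suc (card B)" using True by (simp add: card_image)
    moreover have "?f ` ?I \<subseteq> complex_vector.span B"
      using funpow_in_invariant[where M = M and A = A, OF inv v] B(2) by blast
    ultimately have "complex_vector.dependent (?f ` ?I)"
      using complex_vector.independent_span_bound[OF B(1)] by (metis Suc_n_not_le_n)
    then obtain u where u: "\<exists>w\<in>?f ` ?I. u w \<noteq> 0" "(\<Sum>w\<in>?f ` ?I. u w *\<^sub>C w) = 0"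
      using complex_vector.dependent_finite[of "?f ` ?I"] by auto
    then show ?thesis using True by (intro exI[of _ "\<lambda>i. u (?f i)"]) (auto simp: sum.reindex)
  next
    case False
    then obtain i j where ij: "i \<in> ?I" "j \<in> ?I" "i \<noteq> j" "?f i = ?f j"
      by (auto simp: inj_on_def)
    have "(\<Sum>k\<in>?I. ((if k = i then 1 else 0) - (if k = j then 1 else 0)) *\<^sub>C ?f k)
        = (\<Sum>k\<in>?I. if k = i then ?f k else 0) - (\<Sum>k\<in>?I. if k = j then ?f k else 0)"
      unfolding sum_subtractf[symmetric] by (rule sum.cong) (auto simp: ij)
    also have "\<dots> = 0" using ij by simp
    finally show ?thesis
      using ij by (intro exI[of _ "\<lambda>k. (if k = i then 1 else 0) - (if k = j then 1 else 0)"]) auto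
  qed
  then obtain c where c: "\<exists>i\<in>?I. c i \<noteq> 0" "(\<Sum>i\<in>?I. c i *\<^sub>C ?f i) = 0" by blast
  define p where "p = (\<Sum>i\<in>?I. monom (c i) i)"
  have coeff: "coeff p i = (if i \<le> card B then c i else 0)" for i
    by (simp add: p_def coeff_sum)
  have "degree p \<le> card B" by (rule degree_le) (simp add: coeff)
  then have "op_poly A p v = 0" using c(2) by (simp add: op_poly_altdef coeff)
  moreover have "p \<noteq> 0" using c(1) coeff by (metis atMost_iff coeff_0)
  ultimately show thesis using that by blast
qed

text \<open>Take a nonzero \<open>p\<close> of least degree with \<open>p(A) v = 0\<close>. It is
  not constant since \<open>v\<close> is nonzero, so it has a root \<open>c\<close> and a
  factorization \<open>(X - c) q\<close>; by minimality \<open>q(A) v\<close> is nonzero, and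
  \<open>A - c\<close> kills it.\<close>

lemma cfinite_dim_eigenvector:
  assumes A: "Vector_Spaces.linear scaleC scaleC A" and fin: "cfinite_dim M"
    and inv: "\<And>x. x \<in> M \<Longrightarrow> A x \<in> M" and v: "v \<in> M" "v \<noteq> 0"
  obtains w c where "w \<in> M" "w \<noteq> 0" "A w = c *\<^sub>C w"
proof -
  let ?P = "\<lambda>p. p \<noteq> 0 \<and> op_poly A p v = 0"
  obtain p0 where p0: "?P p0"
    using cfinite_dim_annihilating_poly[of M A v, OF fin inv v(1)] by blast
  obtain p where p: "p \<noteq> 0" "op_poly A p v = 0"
    and min: "\<And>q. q \<noteq> 0 \<Longrightarrow> op_poly A q v = 0 \<Longrightarrow> degree p \<le> degree q"
    using ex_has_least_nat[of ?P p0 degree, OF p0] by auto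
  have "degree p \<noteq> 0"
  proof
    assume d: "degree p = 0"
    then have "op_poly A p v = coeff p 0 *\<^sub>C v" by (simp add: op_poly_def)
    then show False using p v(2) d by (metis complex_vector.scale_eq_0_iff leading_coeff_0_iff)
  qed
  then obtain c where "poly p c = 0"
    using fundamental_theorem_of_algebra[of p] by (auto simp: constant_degree)
  then obtain q where q: "p = [:-c, 1:] * q" using poly_eq_0_iff_dvd by blast
  then have "q \<noteq> 0" using p(1) by auto
  then have "degree p = Suc (degree q)"
    unfolding q by (subst degree_mult_eq) auto
  then have "op_poly A q v \<noteq> 0" using min[OF \<open>q \<noteq> 0\<close>] by auto
  moreover have "A (op_poly A q v) = c *\<^sub>C op_poly A q v"
    using p(2) unfolding q op_poly_linear_factor[OF A] by simp
  moreover have "op_poly A q v \<in> M"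
  proof -
    obtain B where "complex_vector.span B = M" using fin by (auto simp: cfinite_dim_def)
    then have "complex_vector.subspace M" using complex_vector.subspace_span by blast
    then show ?thesis
      unfolding op_poly_def using funpow_in_invariant[where M = M and A = A, OF inv v(1)]
      by (intro complex_vector.subspace_sum complex_vector.subspace_scale) auto
  qed
  ultimately show thesis using that by blast
qed


section \<open>Sequences with nonpositive iterated differences\<close>

text \<open>The forward difference operator. Along the squared norms of an orbit, its
  \<open>m\<close>-th iterate is the quadratic form that \<open>m\<close>-concavity makes
  nonpositive.\<close>

definition fdiff :: "(nat \<Rightarrow> real) \<Rightarrow> nat \<Rightarrow> real" where
  "fdiff s n = s (Suc n) - s n"

text \<open>Binomial expansion of the \<open>m\<close>-th power of shift minus identity; the
  exponent \<open>m + k\<close> has the parity of \<open>m - k\<close> and avoids subtraction of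
  naturals.\<close>

lemma funpow_fdiff:
  "(fdiff ^^ m) s n = (\<Sum>k\<le>m. (-1) ^ (m + k) * real (m choose k) * s (n + k))"
proof (induction m arbitrary: n)
  case (Suc m)
  \<comment> \<open>Both sums are brought to the range up to \<open>Suc m\<close>, with vanishing
    extra terms, so that Pascal's rule applies term by term.\<close>
  have A: "(\<Sum>k\<le>m. (-1) ^ (m + k) * real (m choose k) * s (Suc n + k))
    = (\<Sum>k\<le>Suc m. if k = 0 then 0 else (-1) ^ (Suc m + k) * real (m choose (k - 1)) * s (n + k))"
    unfolding sum.atMost_Suc_shift by simp
  have B: "(\<Sum>k\<le>m. (-1) ^ (m + k) * real (m choose k) * s (n + k))
    = (\<Sum>k\<le>Suc m. (-1) ^ (m + k) * real (m choose k) * s (n + k))"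
    by simp
  have "(fdiff ^^ Suc m) s n = (fdiff ^^ m) s (Suc n) - (fdiff ^^ m) s n"
    by (simp add: fdiff_def)
  also have "\<dots> = (\<Sum>k\<le>Suc m. (-1) ^ (Suc m + k) * real (Suc m choose k) * s (n + k))"
    unfolding Suc.IH A B sum_subtractf[symmetric]
  proof (rule sum.cong)
    show "(if k = 0 then 0 else (-1) ^ (Suc m + k) * real (m choose (k - 1)) * s (n + k))
        - (-1) ^ (m + k) * real (m choose k) * s (n + k)
      = (-1) ^ (Suc m + k) * real (Suc m choose k) * s (n + k)" for k
      by (cases k) (simp_all add: algebra_simps)
  qed simp
  finally show ?case .
qed simp

text \<open>By induction the first difference has a polynomial upper bound of degree
  \<open>m\<close>, and summing it raises the degree by one.\<close>

lemma funpow_fdiff_nonpos_growth: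
  assumes "\<And>n. (fdiff ^^ m) s n \<le> 0"
  shows "\<exists>C\<ge>0. \<forall>n. s n \<le> C * (real n + 1) ^ m"
  using assms
proof (induction m arbitrary: s)
  case 0
  then show ?case by (intro exI[of _ 0]) auto
next
  case (Suc m)
  have "\<exists>C\<ge>0. \<forall>n. fdiff s n \<le> C * (real n + 1) ^ m"
    using Suc.prems by (intro Suc.IH) (simp add: funpow_swap1 funpow_Suc_right del: funpow.simps)
  then obtain C where C: "C \<ge> 0" "\<And>n. fdiff s n \<le> C * (real n + 1) ^ m" by blast
  \<comment> \<open>\<open>D\<close> must dominate both the initial value \<open>s 0\<close> and the
    bound \<open>C\<close> on the increments.\<close>
  define D where "D = max C \<bar>s 0\<bar>"
  have D: "D \<ge> C" "D \<ge> s 0" "D \<ge> 0" by (auto simp: D_def)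
  have "s n \<le> D * (real n + 1) ^ Suc m" for n
  proof (induction n)
    case 0
    then show ?case using D by simp
  next
    case (Suc n)
    have "s (Suc n) \<le> D * (real n + 1) ^ Suc m + C * (real n + 1) ^ m"
      using Suc C(2)[of n] by (simp add: fdiff_def)
    also have "\<dots> \<le> D * (real n + 1) ^ Suc m + D * (real n + 1) ^ m"
      using D by (intro add_left_mono mult_right_mono) auto
    also have "\<dots> = D * (real n + 2) * (real n + 1) ^ m" by (simp add: algebra_simps)
    also have "\<dots> \<le> D * (real n + 2) * (real n + 2) ^ m"
      using D by (intro mult_left_mono power_mono) auto
    finally show ?case by (simp add: add.commute mult.assoc)
  qed
  then show ?case using D(3) by blast
qed

text \<open>If \<open>r > 1\<close>, dividing by \<open>r ^ n\<close> bounds the positive constant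
  \<open>a\<close> by a sequence tending to 0.\<close>

lemma polynomial_dominates_power_imp_le_1:
  fixes r a C :: real
  assumes "a > 0" and bound: "\<And>n. r ^ n * a \<le> C * (real n + 1) ^ m"
  shows "r \<le> 1"
proof (rule ccontr)
  assume "\<not> r \<le> 1"
  then have r: "r > 1" by simp
  have "(\<lambda>n. C * (real n + 1) ^ m / r ^ n) \<longlonglongrightarrow> 0"
    using r by real_asymp
  moreover have "a \<le> C * (real n + 1) ^ m / r ^ n" for n
    using bound[of n] r by (simp add: field_simps)
  ultimately have "a \<le> 0" by (intro LIMSEQ_le_const) auto
  then show False using \<open>a > 0\<close> by simp
qed


section \<open>Norm-increasing and \<open>m\<close>-concave operators\<close>

lemma bounded_clinear_bounded_linear:
  assumes "bounded_clinear T"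
  shows "bounded_linear T"
proof -
  interpret T: Vector_Spaces.linear scaleC scaleC T
    using assms by (simp add: bounded_clinear_def)
  obtain K where K: "\<And>x. norm (T x) \<le> K * norm x"
    using assms by (auto simp: bounded_clinear_def)
  show ?thesis
  proof (rule bounded_linear_intro)
    show "T (r *\<^sub>R x) = r *\<^sub>R T x" for r x
      by (metis T.scale scaleC_of_real)
    show "norm (T x) \<le> norm x * K" for x using K by (metis mult.commute)
  qed (rule T.add)
qed

lemma linear_funpow_scaleC:
  fixes A :: "'a::complex_inner \<Rightarrow> 'a"
  assumes "Vector_Spaces.linear scaleC scaleC A"
  shows "(A ^^ n) (c *\<^sub>C x) = c *\<^sub>C (A ^^ n) x"
proof -
  interpret A: Vector_Spaces.linear scaleC scaleC A by fact
  show ?thesis by (induction n) (simp_all add: A.scale)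
qed

lemma linear_cadjoint:
  fixes T :: "'a::chilbert_space \<Rightarrow> 'a"
  assumes "bounded_clinear T"
  shows "Vector_Spaces.linear scaleC scaleC (cadjoint T)"
proof unfold_locales
  show "cadjoint T (x + y) = cadjoint T x + cadjoint T y" for x y
    by (rule cinner_eqI) (simp add: cinner_cadjoint[OF assms, symmetric] cinner_add_right)
  show "cadjoint T (c *\<^sub>C x) = c *\<^sub>C cadjoint T x" for c x
    by (rule cinner_eqI) (simp add: cinner_cadjoint[OF assms, symmetric] cinner_scaleC_right)
qed

lemma cinner_funpow_cadjoint:
  fixes T :: "'a::chilbert_space \<Rightarrow> 'a"
  assumes "bounded_clinear T"
  shows "cinner ((T ^^ n) x) y = cinner x ((cadjoint T ^^ n) y)"
proof (induction n arbitrary: y)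
  case (Suc n)
  have "cinner ((T ^^ Suc n) x) y = cinner ((T ^^ n) x) (cadjoint T y)"
    by (simp add: cinner_cadjoint[OF assms])
  also have "\<dots> = cinner x ((cadjoint T ^^ Suc n) y)"
    unfolding Suc.IH by (simp add: funpow_swap1)
  finally show ?case .
qed simp

lemma norm_increasing_norm_le:
  fixes T :: "'a::chilbert_space \<Rightarrow> 'a"
  assumes "bounded_clinear T" "norm_increasing T"
  shows "norm x \<le> norm (T x)"
proof -
  have "cinner (cadjoint T (T x) - x) x \<in> \<real>\<^sub>\<ge>\<^sub>0"
    using assms(2) by (simp add: norm_increasing_def op_le_def positive_op_def)
  moreover have "cinner (cadjoint T (T x)) x = cinner (T x) (T x)"
    by (metis assms(1) cinner_cadjoint cinner_commute)
  ultimately have "(norm x)\<^sup>2 \<le> (norm (T x))\<^sup>2"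
    by (simp add: cinner_diff_left cinner_self complex_nonneg_Reals_iff)
  then show ?thesis by (rule power2_le_imp_le) simp
qed

lemma cinner_sum_left: "cinner (\<Sum>i\<in>I. f i) x = (\<Sum>i\<in>I. cinner (f i) (x :: 'a::complex_inner))"
  by (induction I rule: infinite_finite_induct) (simp_all add: cinner_add_left)

text \<open>With \<open>y\<close> the \<open>n\<close>-th iterate of \<open>x\<close>, the form of
  \<open>(-1) ^ m B_m(T)\<close> at \<open>y\<close> is exactly the \<open>m\<close>-th difference
  at \<open>n\<close> of the squared orbit norms.\<close>

lemma m_concave_fdiff_nonpos:
  fixes T :: "'a::chilbert_space \<Rightarrow> 'a"
  assumes "bounded_clinear T" "m_concave m T"
  shows "(fdiff ^^ m) (\<lambda>n. (norm ((T ^^ n) x))\<^sup>2) n \<le> 0"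
proof -
  define y where "y = (T ^^ n) x"
  have adj: "cinner ((cadjoint T ^^ k) z) w = cinner z ((T ^^ k) w)" for k z w
    by (metis assms(1) cinner_funpow_cadjoint cinner_commute)
  have "cinner (B_op m T y) y
      = (\<Sum>k\<le>m. (-1) ^ k * of_nat (m choose k) * complex_of_real ((norm ((T ^^ k) y))\<^sup>2))"
    by (simp only: B_op_def cinner_sum_left cinner_scaleC_left adj cinner_self atLeast0AtMost)
  also have "\<dots> = complex_of_real
      (\<Sum>k\<le>m. (-1) ^ k * real (m choose k) * (norm ((T ^^ k) y))\<^sup>2)"
    by simp
  finally have B: "cinner ((-1) ^ m *\<^sub>C B_op m T y) y = complex_of_real
      ((-1) ^ m * (\<Sum>k\<le>m. (-1) ^ k * real (m choose k) * (norm ((T ^^ k) y))\<^sup>2))"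
    by (simp add: cinner_scaleC_left)
  have "cinner (0 - (-1) ^ m *\<^sub>C B_op m T y) y \<in> \<real>\<^sub>\<ge>\<^sub>0"
    using assms(2) by (simp only: m_concave_def op_le_def positive_op_def)
  then have "(-1) ^ m * (\<Sum>k\<le>m. (-1) ^ k * real (m choose k) * (norm ((T ^^ k) y))\<^sup>2) \<le> 0"
    unfolding cinner_diff_left B by (simp add: complex_nonneg_Reals_iff del: of_real_mult)
  also have "(-1) ^ m * (\<Sum>k\<le>m. (-1) ^ k * real (m choose k) * (norm ((T ^^ k) y))\<^sup>2)
      = (fdiff ^^ m) (\<lambda>n. (norm ((T ^^ n) x))\<^sup>2) n"
    by (simp add: funpow_fdiff y_def sum_distrib_left power_add mult.assoc funpow_add add.commute[of n])
  finally show ?thesis .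
qed

text \<open>Duality makes the orbit of \<open>v\<close> under \<open>T\<close> grow at least like
  \<open>cmod c ^ n\<close>, whereas \<open>m\<close>-concavity bounds its squared norms
  polynomially.\<close>

lemma m_concave_cadjoint_eigenvalue:
  fixes T :: "'a::chilbert_space \<Rightarrow> 'a"
  assumes T: "bounded_clinear T" and "m_concave m T"
    and v: "cadjoint T v = c *\<^sub>C v" "v \<noteq> 0"
  shows "cmod c \<le> 1"
proof -
  have lin: "Vector_Spaces.linear scaleC scaleC T" using T by (simp add: bounded_clinear_def)
  interpret A: Vector_Spaces.linear scaleC scaleC "cadjoint T" by (rule linear_cadjoint[OF T])
  have adj: "(cadjoint T ^^ n) v = c ^ n *\<^sub>C v" for n
  proof (induction n)
    case (Suc n)
    then show ?case by (simp add: A.scale v(1) scaleC_scaleC mult.commute)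
  qed simp
  have le: "cmod c ^ n * norm v \<le> norm ((T ^^ n) v)" for n
  \<comment> \<open>Cauchy-Schwarz yields the claim multiplied by the norm of
    \<open>c ^ n *\<^sub>C v\<close>, which can be cancelled only if nonzero.\<close>
  proof (cases "c ^ n = 0")
    case False
    have "(cmod c ^ n * norm v)\<^sup>2 = inner (c ^ n *\<^sub>C v) ((cadjoint T ^^ n) v)"
      by (simp add: adj power2_norm_eq_inner[symmetric] norm_scaleC norm_power)
    also have "\<dots> = inner ((T ^^ n) (c ^ n *\<^sub>C v)) v"
      by (metis Re_cinner cinner_funpow_cadjoint[OF T])
    also have "\<dots> \<le> norm ((T ^^ n) (c ^ n *\<^sub>C v)) * norm v" by (rule norm_cauchy_schwarz)
    also have "\<dots> = (cmod c ^ n * norm v) * norm ((T ^^ n) v)"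
      by (simp add: linear_funpow_scaleC[OF lin] norm_scaleC norm_power)
    finally have "(cmod c ^ n * norm v) * (cmod c ^ n * norm v)
        \<le> (cmod c ^ n * norm v) * norm ((T ^^ n) v)"
      by (simp only: power2_eq_square)
    moreover have "cmod c ^ n * norm v > 0"
      using False v(2) by (simp add: norm_power[symmetric])
    ultimately show ?thesis by (simp only: mult_le_cancel_left_pos)
  next
    case True
    then show ?thesis by (metis norm_power norm_zero mult_zero_left norm_ge_zero)
  qed
  obtain C where C: "\<And>n. (norm ((T ^^ n) v))\<^sup>2 \<le> C * (real n + 1) ^ m"
    using funpow_fdiff_nonpos_growth[OF m_concave_fdiff_nonpos[OF T assms(2)]] by blast
  have "((cmod c)\<^sup>2) ^ n * (norm v)\<^sup>2 \<le> C * (real n + 1) ^ m" for n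
  proof -
    have "(cmod c ^ n * norm v)\<^sup>2 \<le> (norm ((T ^^ n) v))\<^sup>2" by (intro power_mono le) simp
    also have "\<dots> \<le> C * (real n + 1) ^ m" by (rule C)
    finally show ?thesis by (simp add: power_mult_distrib power_mult[symmetric] mult.commute)
  qed
  then have "(cmod c)\<^sup>2 \<le> 1" using v(2) by (intro polynomial_dominates_power_imp_le_1) auto
  then show ?thesis by (simp add: power_le_one_iff)
qed

section \<open>Range of the operator and complement of the invariant hull\<close>

text \<open>Project \<open>x\<close> to \<open>p\<close> in the closed range of \<open>T\<close>.
  Then \<open>x - p\<close> lies in \<open>ker_adj T\<close>, so it is orthogonal to
  \<open>x\<close> as well as to \<open>p\<close>, hence to itself.\<close>

lemma orth_compl_ker_adj_subset_range:
  fixes T :: "'a::chilbert_space \<Rightarrow> 'a"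
  assumes T: "bounded_clinear T" and "norm_increasing T"
  shows "orth_compl (ker_adj T) \<subseteq> range T"
proof
  fix x assume x: "x \<in> orth_compl (ker_adj T)"
  interpret T: Vector_Spaces.linear scaleC scaleC T
    using T by (simp add: bounded_clinear_def)
  have "complex_vector.subspace (range T)"
    by (rule T.subspace_image) (simp add: complex_vector.subspace_UNIV)
  \<comment> \<open>\<open>T\<close> is bounded below with constant 1, so Cauchy sequences in the
    range come from Cauchy sequences of preimages.\<close>
  moreover have "complete (range T)"
    using complete_isometric_image[OF zero_less_one subspace_UNIV
        bounded_clinear_bounded_linear[OF T] _ complete_UNIV]
      norm_increasing_norm_le[OF assms] by simp
  ultimately obtain p where p: "p \<in> range T" "x - p \<in> orth_compl (range T)"
    using closed_complex_subspace_projection complete_imp_closed by metis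
  have "cadjoint T (x - p) = 0"
  proof (rule cinner_eqI)
    fix z
    have "cinner z (cadjoint T (x - p)) = cnj (cinner (x - p) (T z))"
      by (metis T cinner_cadjoint cinner_commute)
    then show "cinner z (cadjoint T (x - p)) = cinner z 0"
      using p(2) by (simp add: orth_compl_def)
  qed
  then have "cinner x (x - p) = 0" using x by (simp add: orth_compl_def ker_adj_def)
  moreover have "cinner p (x - p) = 0"
    using p by (metis (mono_tags, lifting) cinner_commute complex_cnj_zero mem_Collect_eq
        orth_compl_def)
  ultimately have "cinner (x - p) (x - p) = 0" by (simp add: cinner_diff_left)
  then have "x = p" by (simp add: cinner_self)
  then show "x \<in> range T" using p(1) by simp
qed

text \<open>Powers of \<open>T\<close> move to the other side of \<open>cinner\<close> as powers of
  the adjoint. In this form, invariance of the complement under \<open>cadjoint T\<close> is a shift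
  of \<open>n\<close>.\<close>

lemma orth_compl_invariant_hull:
  fixes T :: "'a::chilbert_space \<Rightarrow> 'a"
  assumes "bounded_clinear T"
  shows "orth_compl (invariant_hull T E) = {x. \<forall>n. (cadjoint T ^^ n) x \<in> orth_compl E}"
proof -
  have "cinner x ((T ^^ n) h) = cinner ((cadjoint T ^^ n) x) h" for x n h
    by (metis assms cinner_funpow_cadjoint cinner_commute)
  then show ?thesis
    unfolding invariant_hull_def orth_compl_closure_span by (fastforce simp: orth_compl_def)
qed

lemma analytic_no_cadjoint_eigenvector:
  fixes T :: "'a::chilbert_space \<Rightarrow> 'a"
  assumes T: "bounded_clinear T" and "analytic_op T" "norm_increasing T"
    and "v \<in> range T" "cadjoint T v = c *\<^sub>C v" "cmod c \<le> 1"
  shows "v = 0"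
proof -
  obtain u where u: "v = T u" using assms(4) by blast
  have "inner (c *\<^sub>C T u) u = inner (cadjoint T (T u)) u" using assms(5) u by simp
  also have "\<dots> = inner (T u) (T u)" by (metis T Re_cinner cinner_cadjoint cinner_commute)
  finally have inner: "inner (c *\<^sub>C T u) u = (norm (T u))\<^sup>2" by (simp add: power2_norm_eq_inner)
  have "norm (c *\<^sub>C T u) \<le> norm (T u)"
    using assms(6) by (simp add: norm_scaleC mult_left_le_one_le)
  then have "(norm (c *\<^sub>C T u))\<^sup>2 \<le> (norm (T u))\<^sup>2" by (rule power_mono) simp
  moreover have "(norm u)\<^sup>2 \<le> (norm (T u))\<^sup>2"
    using norm_increasing_norm_le[OF T assms(3)] by (rule power_mono) simp
  \<comment> \<open>The middle term is twice the squared norm of \<open>T u\<close>, while each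
    outer term is at most that squared norm once; so the total is at most 0.\<close>
  moreover have "(norm (c *\<^sub>C T u - u))\<^sup>2
      = (norm (c *\<^sub>C T u))\<^sup>2 - 2 * inner (c *\<^sub>C T u) u + (norm u)\<^sup>2"
    by (simp add: power2_norm_eq_inner inner_diff inner_commute)
  ultimately have "(norm (c *\<^sub>C T u - u))\<^sup>2 \<le> 0" using inner by linarith
  then have "u = c *\<^sub>C v" using u by simp
  interpret T: Vector_Spaces.linear scaleC scaleC T
    using T by (simp add: bounded_clinear_def)
  have step: "v = T (c *\<^sub>C v)" using u \<open>u = c *\<^sub>C v\<close> by simp
  \<comment> \<open>Iterating \<open>v = T (c v)\<close> exhibits \<open>v\<close> in the range of
    every power of \<open>T\<close>.\<close>
  have "v = (T ^^ n) (c ^ n *\<^sub>C v)" for n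
  proof (induction n)
    case (Suc n)
    have "(T ^^ Suc n) (c ^ Suc n *\<^sub>C v) = (T ^^ n) (T (c ^ n *\<^sub>C c *\<^sub>C v))"
      by (simp add: funpow_swap1 scaleC_scaleC mult.commute)
    also have "\<dots> = (T ^^ n) (c ^ n *\<^sub>C v)" by (metis T.scale step)
    finally show ?case using Suc by simp
  qed simp
  then have "v \<in> (\<Inter>n. range (T ^^ n))" by blast
  then show ?thesis using assms(2) unfolding analytic_op_def by blast
qed

theorem theorem4p3:
  fixes T :: "'h::chilbert_space \<Rightarrow> 'h" and m :: nat
  assumes "separable_space (euclidean :: 'h topology)"
    and "\<not> cfinite_dim (UNIV :: 'h set)"
    and "m \<ge> 2"
    and "bounded_clinear T"
    and "analytic_op T"
    and "norm_increasing T"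
    and "m_concave m T"
  shows "wandering_subspace_property T \<or>
    \<not> cfinite_dim (orth_compl (invariant_hull T (ker_adj T)))"
proof (rule disjCI)
  let ?M = "orth_compl (invariant_hull T (ker_adj T))"
  assume "\<not> \<not> cfinite_dim ?M"
  then have fin: "cfinite_dim ?M" by simp
  note M = orth_compl_invariant_hull[OF assms(4), of "ker_adj T"]
  have inv: "cadjoint T x \<in> ?M" if "x \<in> ?M" for x
  proof -
    have "(cadjoint T ^^ Suc n) x \<in> orth_compl (ker_adj T)" for n using that unfolding M by blast
    then show ?thesis unfolding M by (simp add: funpow_swap1)
  qed
  have "v = 0" if v: "v \<in> ?M" for v
  proof (rule ccontr)
    assume "v \<noteq> 0"
    then obtain w c where w: "w \<in> ?M" "w \<noteq> 0" "cadjoint T w = c *\<^sub>C w"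
      using cfinite_dim_eigenvector[OF linear_cadjoint[OF assms(4)] fin inv v] by blast
    \<comment> \<open>The exponent 0 in the description of the complement gives orthogonality of
      \<open>w\<close> itself to \<open>ker_adj T\<close>.\<close>
    have "(cadjoint T ^^ 0) w \<in> orth_compl (ker_adj T)" using w(1) unfolding M by blast
    then have "w \<in> range T" using orth_compl_ker_adj_subset_range[OF assms(4,6)] by auto
    moreover have "cmod c \<le> 1"
      using m_concave_cadjoint_eigenvalue[OF assms(4,7) w(3,2)] .
    ultimately show False using analytic_no_cadjoint_eigenvector[OF assms(4-6)] w(2,3) by blast
  qed
  moreover have "0 \<in> ?M" by (simp add: orth_compl_def)
  ultimately have "?M = {0}" by blast
  then show "wandering_subspace_property T"
    unfolding wandering_subspace_property_def invariant_hull_def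
    by (intro orth_compl_closure_eq_zero complex_vector.subspace_span)
qed

end
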